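(* Let $k$ and $l$ be non-zero integers. There exist a torsion-free group $G$ (written multiplicatively, not necessarily abelian) and a $2$-element subset $X$ of $G$ such that $|X^{\cdot k} X^{\cdot l}| < 3|X|-2$.
   Context: For a subset $X$ of a multiplicatively written group and an integer $k$, $X^{\cdot k}=\{x^k : x\in X\}$ (the set of $k$-th powers of the elements of $X$). For subsets $A,B$ of the group, $AB=\{ab : a\in A,\ b\in B\}$. A group is torsion-free if no element other than the identity has finite order. *)

theory Defs
  imports "HOL-Algebra.Coset"
begin

(* HOL cannot quantify existentially over types, so existence of a group is expressed with
   nat monoid, i.e. with a set of natural numbers as carrier. For a statement about a finite subset
   X of the group nothing is lost: the subgroup generated by X is countable, so its structure
   can be transported to a set of naturals. *)

definition torsion_free :: "('a, 'b) monoid_scheme \<Rightarrow> bool" where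
  "torsion_free G \<longleftrightarrow>
     (\<forall>x \<in> carrier G. x \<noteq> \<one>\<^bsub>G\<^esub> \<longrightarrow> (\<forall>n::nat. n > 0 \<longrightarrow> x [^]\<^bsub>G\<^esub> n \<noteq> \<one>\<^bsub>G\<^esub>))"

(* The elementwise k-th powers of X, not the k-fold product set X \<cdots> X. *)
definition power_set :: "('a, 'b) monoid_scheme \<Rightarrow> int \<Rightarrow> 'a set \<Rightarrow> 'a set" where
  "power_set G k X = (\<lambda>x. x [^]\<^bsub>G\<^esub> k) ` X"

end

theory Submission
  imports Defs Complex_Main "HOL-Library.Countable_Set"
    "HOL-Algebra.Generated_Groups" "HOL-Algebra.Weak_Morphisms"
begin

text \<open>
  A product set of two \<open>2\<close>-element sets has at most four elements, so the bound asks for a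
  single coincidence among the products \<open>x\<^sup>k x\<^sup>l\<close>, \<open>x\<^sup>k y\<^sup>l\<close>, \<open>y\<^sup>k x\<^sup>l\<close>, \<open>y\<^sup>k y\<^sup>l\<close>.

  If \<open>k = \<plusminus>l\<close>, any nontrivial torsion-free group works with \<open>X = {x, \<one>}\<close>: either
  \<open>x\<^sup>k \<one>\<^sup>l = \<one>\<^sup>k x\<^sup>l\<close>, or \<open>x\<^sup>k x\<^sup>l = \<one> = \<one>\<^sup>k \<one>\<^sup>l\<close>. Otherwise one of the two exponents, say \<open>n\<close>, has
  absolute value at least \<open>2\<close>, and it suffices that roots are not unique: if \<open>x \<noteq> y\<close> and
  \<open>x\<^sup>n = y\<^sup>n\<close>, then one of the two factors of the product set is a singleton.

  Torsion-free groups with non-unique \<open>n\<close>-th roots are semidirect products: let the generator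
  of \<open>\<int>\<close> act on the additive group \<open>\<complex>\<close> as multiplication by a root of unity \<open>\<zeta> \<noteq> 1\<close> with
  \<open>\<zeta>\<^sup>n = 1\<close>. An extension of torsion-free groups is torsion-free, and
  \<open>(a, 1)\<^sup>n = ((1 + \<zeta> + \<dots> + \<zeta>\<^bsup>n-1\<^esup>) a, n) = (0, n)\<close> for every \<open>a\<close>, because the geometric sum vanishes; here
  \<open>n > 0\<close>, and taking inverses gives the negative exponents (lemmas \<open>torsion_free_twisted_group\<close> and \<open>twisted_group_pow_eq\<close>). Since the carrier has to be
  a set of natural numbers, this group is cut down to the subgroup generated by \<open>(0, 1)\<close> and
  \<open>(1, 1)\<close>, which is countable (lemma \<open>torsion_free_nat_copy\<close>).
\<close>

section \<open>Copies of countably generated groups on the natural numbers\<close>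

text \<open>
  Every element of a generated subgroup is a word in the generators and their inverses, and there
  are only countably many words over a countable alphabet.
\<close>

lemma (in group) countable_generate:
  assumes "S \<subseteq> carrier G" and "countable S"
  shows "countable (generate G S)"
proof -
  let ?A = "S \<union> m_inv G ` S"
  let ?val = "\<lambda>w. foldr (\<otimes>) w \<one>"
  have A: "?A \<subseteq> carrier G"
    using assms(1) by auto
  have closed: "?val w \<in> carrier G" if "set w \<subseteq> ?A" for w
    using that A by (induction w) auto
  have append: "?val (v @ w) = ?val v \<otimes> ?val w" if "set v \<subseteq> ?A" "set w \<subseteq> ?A" for v w
    using that(1)
  proof (induction v)
    case Nil
    then show ?case using closed[OF that(2)] by simp
  next
    case (Cons a v)
    then have "a \<in> carrier G" using A by auto
    then show ?case using Cons closed[of v] closed[OF that(2)] by (simp add: m_assoc)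
  qed
  have "generate G S \<subseteq> ?val ` lists ?A"
  proof
    fix g assume "g \<in> generate G S"
    then show "g \<in> ?val ` lists ?A"
    proof (induction rule: generate.induct)
      case one
      show ?case by (rule image_eqI[of _ _ "[]"]) auto
    next
      case (incl h)
      then show ?case using assms(1) by (intro image_eqI[of _ _ "[h]"]) auto
    next
      case (inv h)
      then show ?case using assms(1) by (intro image_eqI[of _ _ "[inv h]"]) auto
    next
      case (eng g h)
      then obtain v w where "v \<in> lists ?A" "g = ?val v" "w \<in> lists ?A" "h = ?val w"
        by auto
      then have "g \<otimes> h = ?val (v @ w)" "v @ w \<in> lists ?A"
        using append[of v w] by (auto simp: lists_eq_set)
      then show ?case
        by (rule image_eqI)
    qed
  qed
  moreover have "countable ?A"
    using assms(2) by simp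
  ultimately show ?thesis
    by (meson countable_image countable_lists countable_subset)
qed

lemma (in group) torsion_free_subgroup:
  assumes "torsion_free G" and "subgroup K G"
  shows "torsion_free (G\<lparr>carrier := K\<rparr>)"
  using assms subgroup.subset[OF assms(2)]
  by (auto simp: torsion_free_def nat_pow_consistent[symmetric])

lemma torsion_free_iso:
  assumes "group G" "group H" "h \<in> iso G H" and "torsion_free G"
  shows "torsion_free H"
  unfolding torsion_free_def
proof (intro ballI impI allI notI)
  fix y and n :: nat
  assume y: "y \<in> carrier H" "y \<noteq> \<one>\<^bsub>H\<^esub>" and n: "0 < n" "y [^]\<^bsub>H\<^esub> n = \<one>\<^bsub>H\<^esub>"
  have hom: "h \<in> hom G H" and bij: "bij_betw h (carrier G) (carrier H)"
    using assms(3) by (auto simp: iso_def)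
  interpret group_hom G H h
    using assms hom by (simp add: group_hom_def group_hom_axioms_def)
  obtain x where x: "x \<in> carrier G" "y = h x"
    using y(1) bij by (auto simp: bij_betw_def)
  have "h (x [^]\<^bsub>G\<^esub> n) = h \<one>\<^bsub>G\<^esub>"
    using n(2) x by (simp add: hom_nat_pow)
  then have "x [^]\<^bsub>G\<^esub> n = \<one>\<^bsub>G\<^esub>"
    using bij x(1) inj_onD[of h "carrier G"] by (simp add: bij_betw_def del: hom_one)
  moreover have "x \<noteq> \<one>\<^bsub>G\<^esub>"
    using x y(2) by auto
  ultimately show False
    using assms(4) x(1) n(1) by (auto simp: torsion_free_def)
qed

lemma (in group) torsion_free_nat_copy:
  assumes "torsion_free G" "S \<subseteq> carrier G" "countable S"
  obtains H :: "nat monoid" and h where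
    "group H" "torsion_free H" "h \<in> iso (G\<lparr>carrier := generate G S\<rparr>) H"
proof
  let ?K = "G\<lparr>carrier := generate G S\<rparr>"
  let ?h = "to_nat_on (generate G S)"
  have sub: "subgroup (generate G S) G"
    by (rule generate_is_subgroup[OF assms(2)])
  have K: "group ?K"
    by (rule subgroup.subgroup_is_group[OF sub is_group])
  have inj: "inj_on ?h (carrier ?K)"
    using inj_on_to_nat_on[OF countable_generate[OF assms(2,3)]] by simp
  show iso: "?h \<in> iso ?K (image_group ?h ?K)"
    by (rule inj_imp_image_group_iso[OF inj])
  show grp: "group (image_group ?h ?K)"
    by (rule group.inj_imp_image_group_is_group[OF K inj])
  show "torsion_free (image_group ?h ?K)"
    by (rule torsion_free_iso[OF K grp iso torsion_free_subgroup[OF assms(1) sub]])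
qed

section \<open>Torsion-free groups without unique roots\<close>

text \<open>
  The semidirect product of the additive group of a field with \<open>\<int>\<close>, whose generator acts as
  multiplication by \<open>\<zeta>\<close>.
\<close>

definition twisted_group :: "'a::field \<Rightarrow> ('a \<times> int) monoid" where
  "twisted_group \<zeta> =
     \<lparr>carrier = UNIV, mult = (\<lambda>(a, i) (b, j). (a + \<zeta> powi i * b, i + j)), one = (0, 0)\<rparr>"

lemma twisted_group_simps [simp]:
  "carrier (twisted_group \<zeta>) = UNIV"
  "(a, i) \<otimes>\<^bsub>twisted_group \<zeta>\<^esub> (b, j) = (a + \<zeta> powi i * b, i + j)"
  "\<one>\<^bsub>twisted_group \<zeta>\<^esub> = (0, 0)"
  by (simp_all add: twisted_group_def)

lemma group_twisted_group:
  fixes \<zeta> :: "'a::field"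
  assumes "\<zeta> \<noteq> 0"
  shows "group (twisted_group \<zeta>)"
proof (rule groupI)
  fix u v w :: "'a \<times> int"
  show "u \<otimes>\<^bsub>twisted_group \<zeta>\<^esub> v \<otimes>\<^bsub>twisted_group \<zeta>\<^esub> w =
        u \<otimes>\<^bsub>twisted_group \<zeta>\<^esub> (v \<otimes>\<^bsub>twisted_group \<zeta>\<^esub> w)"
    using assms by (cases u; cases v; cases w) (simp add: power_int_add algebra_simps)
  obtain a i where u: "u = (a, i)"
    by (cases u)
  have "(- (\<zeta> powi - i * a), - i) \<otimes>\<^bsub>twisted_group \<zeta>\<^esub> u = \<one>\<^bsub>twisted_group \<zeta>\<^esub>"
    by (simp add: u)
  then show "\<exists>v\<in>carrier (twisted_group \<zeta>). v \<otimes>\<^bsub>twisted_group \<zeta>\<^esub> u = \<one>\<^bsub>twisted_group \<zeta>\<^esub>"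
    by auto
qed auto

lemma twisted_group_pow:
  "(a, i) [^]\<^bsub>twisted_group \<zeta>\<^esub> n = ((\<Sum>j<n. (\<zeta> powi i) ^ j) * a, i * int n)"
  by (induction n) (simp_all add: power_int_mult algebra_simps)

text \<open>
  A power \<open>u\<^sup>n\<close> has second coordinate \<open>n\<close> times that of \<open>u\<close>, so a torsion element lies in the
  field; there \<open>u\<^sup>n\<close> is \<open>n\<close> times \<open>u\<close>, and characteristic zero excludes torsion.
\<close>

lemma torsion_free_twisted_group:
  fixes \<zeta> :: "'a::field_char_0"
  shows "torsion_free (twisted_group \<zeta>)"
  by (auto simp: torsion_free_def twisted_group_pow)

lemma twisted_group_pow_eq:
  fixes \<zeta> :: "'a::field"
  assumes "\<zeta> ^ n = 1" and "\<zeta> \<noteq> 1"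
  shows "(a, 1) [^]\<^bsub>twisted_group \<zeta>\<^esub> n = (0, int n)"
  using assms by (simp add: twisted_group_pow geometric_sum)

lemma exists_torsion_free_without_unique_roots:
  fixes n :: int
  assumes "\<bar>n\<bar> \<ge> 2"
  obtains H :: "nat monoid" and x y where
    "group H" "torsion_free H" "x \<in> carrier H" "y \<in> carrier H" "x \<noteq> y"
    "x [^]\<^bsub>H\<^esub> n = y [^]\<^bsub>H\<^esub> n"
proof -
  define m where "m = nat \<bar>n\<bar>"
  have m: "m \<ge> 2"
    using assms by (simp add: m_def)
  define \<zeta> where "\<zeta> = cis (2 * pi / real m)"
  have root: "\<zeta> ^ m = 1"
    using m by (simp add: \<zeta>_def DeMoivre)
  have "\<zeta> \<noteq> 1"
  proof
    have inj: "inj_on (\<lambda>k. cis (2 * pi * real k / real m)) {..<m}"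
      using bij_betw_roots_unity[of m] m by (simp add: bij_betw_def)
    assume "\<zeta> = 1"
    then show False
      using inj_onD[OF inj, of 1 0] m by (simp add: \<zeta>_def)
  qed
  define G where "G = twisted_group \<zeta>"
  interpret group G
    unfolding G_def by (rule group_twisted_group) (simp add: \<zeta>_def)
  define u v :: "complex \<times> int" where "u = (0, 1)" and "v = (1, 1)"
  have carrier: "u \<in> carrier G" "v \<in> carrier G"
    by (simp_all add: G_def)
  have "u [^]\<^bsub>G\<^esub> m = v [^]\<^bsub>G\<^esub> m"
    by (simp add: G_def u_def v_def twisted_group_pow_eq[OF root \<open>\<zeta> \<noteq> 1\<close>])
  then have "u [^]\<^bsub>G\<^esub> int m = v [^]\<^bsub>G\<^esub> int m"
    by (simp add: int_pow_int)
  moreover have "n = int m \<or> n = - int m"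
    by (auto simp: m_def)
  ultimately have pow: "u [^]\<^bsub>G\<^esub> n = v [^]\<^bsub>G\<^esub> n"
    using carrier int_pow_neg[of u "int m"] int_pow_neg[of v "int m"] by auto
  have S: "{u, v} \<subseteq> carrier G"
    using carrier by simp
  let ?K = "G\<lparr>carrier := generate G {u, v}\<rparr>"
  obtain H :: "nat monoid" and h where
    H: "group H" "torsion_free H" and iso: "h \<in> iso ?K H"
    using torsion_free_nat_copy[OF _ S] torsion_free_twisted_group by (auto simp: G_def)
  have sub: "subgroup (generate G {u, v}) G"
    by (rule generate_is_subgroup[OF S])
  have in_K: "u \<in> carrier ?K" "v \<in> carrier ?K"
    by (auto intro: generate.incl)
  have K: "group ?K"
    by (rule subgroup.subgroup_is_group[OF sub is_group])
  have hom: "h \<in> hom ?K H" and inj: "inj_on h (carrier ?K)"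
    using iso by (auto simp: iso_def bij_betw_def)
  have "u [^]\<^bsub>?K\<^esub> n = v [^]\<^bsub>?K\<^esub> n"
    using pow in_K int_pow_consistent[OF sub] by simp
  then have "h u [^]\<^bsub>H\<^esub> n = h v [^]\<^bsub>H\<^esub> n"
    using hom_int_pow[OF hom _ K H(1)] in_K by metis
  moreover have "h u \<noteq> h v"
    using inj_onD[OF inj _ in_K] by (auto simp: u_def v_def)
  moreover have "h u \<in> carrier H" "h v \<in> carrier H"
    using hom_in_carrier[OF hom] in_K by blast+
  ultimately show thesis
    using H that by blast
qed

section \<open>Small product sets\<close>

lemma power_set_product_pair:
  "power_set G k {x, y} <#>\<^bsub>G\<^esub> power_set G l {x, y} =
     {x [^]\<^bsub>G\<^esub> k \<otimes>\<^bsub>G\<^esub> x [^]\<^bsub>G\<^esub> l, x [^]\<^bsub>G\<^esub> k \<otimes>\<^bsub>G\<^esub> y [^]\<^bsub>G\<^esub> l,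
      y [^]\<^bsub>G\<^esub> k \<otimes>\<^bsub>G\<^esub> x [^]\<^bsub>G\<^esub> l, y [^]\<^bsub>G\<^esub> k \<otimes>\<^bsub>G\<^esub> y [^]\<^bsub>G\<^esub> l}"
  by (auto simp: power_set_def set_mult_def)

lemma card_le_3_if_coincidence:
  assumes "a = b \<or> a = c \<or> a = d \<or> b = c"
  shows "card {a, b, c, d} \<le> 3"
proof -
  have "card {p, q, r} \<le> 3" for p q r :: 'a
    using card_length[of "[p, q, r]"] by simp
  moreover have "{a, b, c, d} \<in> {{b, c, d}, {a, b, d}, {a, b, c}}"
    using assms by auto
  ultimately show ?thesis
    by auto
qed

theorem theorem2:
  fixes k l :: int
  assumes "k \<noteq> 0" and "l \<noteq> 0"
  shows "\<exists>(G :: nat monoid) X. group G \<and> torsion_free G \<and> X \<subseteq> carrier G \<and> card X = 2 \<and>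
           int (card (power_set G k X <#>\<^bsub>G\<^esub> power_set G l X)) < 3 * int (card X) - 2"
proof -
  have witness: ?thesis
    if "group G" "torsion_free G" "x \<in> carrier G" "y \<in> carrier G" "x \<noteq> y"
      and "x [^]\<^bsub>G\<^esub> k \<otimes>\<^bsub>G\<^esub> x [^]\<^bsub>G\<^esub> l = x [^]\<^bsub>G\<^esub> k \<otimes>\<^bsub>G\<^esub> y [^]\<^bsub>G\<^esub> l \<or>
           x [^]\<^bsub>G\<^esub> k \<otimes>\<^bsub>G\<^esub> x [^]\<^bsub>G\<^esub> l = y [^]\<^bsub>G\<^esub> k \<otimes>\<^bsub>G\<^esub> x [^]\<^bsub>G\<^esub> l \<or>
           x [^]\<^bsub>G\<^esub> k \<otimes>\<^bsub>G\<^esub> x [^]\<^bsub>G\<^esub> l = y [^]\<^bsub>G\<^esub> k \<otimes>\<^bsub>G\<^esub> y [^]\<^bsub>G\<^esub> l \<or>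
           x [^]\<^bsub>G\<^esub> k \<otimes>\<^bsub>G\<^esub> y [^]\<^bsub>G\<^esub> l = y [^]\<^bsub>G\<^esub> k \<otimes>\<^bsub>G\<^esub> x [^]\<^bsub>G\<^esub> l"
    for G :: "nat monoid" and x y
    using that card_le_3_if_coincidence[OF that(6)]
    by (intro exI[of _ G] exI[of _ "{x, y}"]) (simp add: power_set_product_pair)
  consider "\<bar>k\<bar> \<ge> 2" | "\<bar>l\<bar> \<ge> 2" | "k = l \<or> k = - l"
    using assms by linarith
  then show ?thesis
  proof cases
    case 1
    then obtain G :: "nat monoid" and x y where
      G: "group G" "torsion_free G" "x \<in> carrier G" "y \<in> carrier G" "x \<noteq> y"
      and "x [^]\<^bsub>G\<^esub> k = y [^]\<^bsub>G\<^esub> k"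
      by (rule exists_torsion_free_without_unique_roots)
    then show ?thesis by (intro witness[OF G]) simp
  next
    case 2
    then obtain G :: "nat monoid" and x y where
      G: "group G" "torsion_free G" "x \<in> carrier G" "y \<in> carrier G" "x \<noteq> y"
      and "x [^]\<^bsub>G\<^esub> l = y [^]\<^bsub>G\<^esub> l"
      by (rule exists_torsion_free_without_unique_roots)
    then show ?thesis by (intro witness[OF G]) simp
  next
    case 3
    \<comment> \<open>Any nontrivial torsion-free group would do; this one is at hand.\<close>
    obtain G :: "nat monoid" and y z where
      G: "group G" "torsion_free G" and "y \<in> carrier G" "z \<in> carrier G" "y \<noteq> z"
      by (rule exists_torsion_free_without_unique_roots[of 2]) auto
    then obtain x where x: "x \<in> carrier G" "x \<noteq> \<one>\<^bsub>G\<^esub>"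
      by metis
    interpret group G by (rule G(1))
    from 3 show ?thesis
      using x(1) by (intro witness[OF G x(1) one_closed x(2)]) (auto simp: int_pow_neg)
  qed
qed

end
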